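(* Let $X$ and $Y$ be discrete random variables taking values in the same abelian group, and suppose that $$\mathbf{A}\{X,Y\}\ge \frac32\mathbf{H}\{X\}+\frac32\mathbf{H}\{Y\}-\log C$$ for some constant $C$. Then letting $(X_1,Y_1)$ and $(X_2,Y_2)$ be conditionally independent trials of $(X,Y)$ relative to $X+Y$, we have $$\mathbf{H}\{X_1\mid X+Y\}\ge \mathbf{H}\{X\}-2\log C$$ and $$\mathbf{H}\{Y_2\mid X+Y\}\ge \mathbf{H}\{Y\}-2\log C.$$ Furthermore, the variables $X_1$ and $Y_2$ are conditionally independent relative to $X+Y$, and we have $$\mathbf{H}\{X_1+Y_2\mid X+Y\}\le \frac12\mathbf{H}\{X\}+\frac12\mathbf{H}\{Y\}+\log C.$$
   Context: $\log$ is the base-2 logarithm. $\mathbf{H}$ denotes Shannon entropy in base 2, with values in $[0,\infty]$: $\mathbf{H}\{Z\}=\sum_z \mathbf{P}\{Z=z\}\log(1/\mathbf{P}\{Z=z\})$; $\mathbf{H}\{X,Y\}$ is the entropy of the pair $(X,Y)$ (and similarly for longer tuples), and $\mathbf{H}\{X\mid Z\}=\sum_z\mathbf{P}\{Z=z\}\,\mathbf{H}\{X\mid Z=z\}$ is conditional entropy, which satisfies $\mathbf{H}\{X,Z\}=\mathbf{H}\{X\mid Z\}+\mathbf{H}\{Z\}$. For discrete random variables $X,Y$ in the same abelian group (not assumed independent), $(X_1,Y_1)$ and $(X_2,Y_2)$ are conditionally independent trials of $(X,Y)$ relative to $X+Y$ if, for each $z$ in the range of $X+Y$, conditionally on $X+Y=z$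 the pairs $(X_1,Y_1)$ and $(X_2,Y_2)$ are independent and each has the distribution of $(X,Y)$ given $X+Y=z$ (so $X_1+Y_1=X_2+Y_2=X+Y$). The entropic additive energy is $\mathbf{A}\{X,Y\}=\mathbf{H}\{X_1,Y_1,X_2,Y_2\}$, which can be rewritten as $2\mathbf{H}\{X,Y\}-\mathbf{H}\{X+Y\}$.
   Formalization: The two lower bounds on H{X_1|X+Y} and H{Y_2|X+Y} are stated only when H{X} and H{Y} are both finite; they fail otherwise (e.g. Y=0, H{X}=∞). Conditional independence and the upper bound are unrestricted. *)

theory Defs
  imports "HOL-Probability.Probability"
begin

text \<open>
  A discrete random variable has countably many values, and all its fibres are events.
\<close>

definition discrete_rv :: "'w measure \<Rightarrow> ('w \<Rightarrow> 'a) \<Rightarrow> bool" where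
  "discrete_rv M X \<longleftrightarrow> X \<in> measurable M (count_space UNIV) \<and> countable (X ` space M)"

text \<open>
  The library's entropy is real-valued, being \<open>0\<close> where the defining sum diverges, so an
  extended-real version is used here. Values of probability \<open>0\<close> contribute \<open>0\<close> to the sum,
  as does every point outside the range of the variable.
\<close>

definition shannon :: "'w measure \<Rightarrow> ('w \<Rightarrow> 'a) \<Rightarrow> ereal" where
  "shannon M X = (\<Sum>\<^sub>\<infinity>x.
     let p = measure M {w \<in> space M. X w = x} in ereal (p * log 2 (1 / p)))"

text \<open>
  The measure \<open>M\<close> conditioned on \<open>Z = z\<close>. It is a probability measure only when that event has
  positive probability, and is the zero measure otherwise.
\<close>

definition conditioned :: "'w measure \<Rightarrow> ('w \<Rightarrow> 'c) \<Rightarrow> 'c \<Rightarrow> 'w measure" where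
  "conditioned M Z z = uniform_measure M {w \<in> space M. Z w = z}"

definition cond_shannon :: "'w measure \<Rightarrow> ('w \<Rightarrow> 'a) \<Rightarrow> ('w \<Rightarrow> 'c) \<Rightarrow> ereal" where
  "cond_shannon M X Z = (\<Sum>\<^sub>\<infinity>z.
     ereal (measure M {w \<in> space M. Z w = z}) * shannon (conditioned M Z z) X)"

definition cond_indep :: "'w measure \<Rightarrow> ('w \<Rightarrow> 'a) \<Rightarrow> ('w \<Rightarrow> 'a) \<Rightarrow> ('w \<Rightarrow> 'c) \<Rightarrow> bool" where
  "cond_indep M X Y Z \<longleftrightarrow>
     (\<forall>z. measure M {w \<in> space M. Z w = z} > 0 \<longrightarrow>
        prob_space.indep_var (conditioned M Z z) (count_space UNIV) X (count_space UNIV) Y)"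

text \<open>
  All variables live on one space \<open>M\<close>, which may have to be an extension of the space on which
  \<open>X\<close> and \<open>Y\<close> were first given. The identities \<open>X1 + Y1 = X2 + Y2 = X + Y\<close> (almost surely) are
  consequences of the equality of conditional distributions.
\<close>

definition cond_indep_trials ::
  "'w measure \<Rightarrow> ('w \<Rightarrow> 'g::ab_group_add) \<Rightarrow> ('w \<Rightarrow> 'g) \<Rightarrow>
   ('w \<Rightarrow> 'g) \<Rightarrow> ('w \<Rightarrow> 'g) \<Rightarrow> ('w \<Rightarrow> 'g) \<Rightarrow> ('w \<Rightarrow> 'g) \<Rightarrow> bool" where
  "cond_indep_trials M X Y X1 Y1 X2 Y2 \<longleftrightarrow>
     discrete_rv M X1 \<and> discrete_rv M Y1 \<and> discrete_rv M X2 \<and> discrete_rv M Y2 \<and>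
     cond_indep M (\<lambda>w. (X1 w, Y1 w)) (\<lambda>w. (X2 w, Y2 w)) (\<lambda>w. X w + Y w) \<and>
     (\<forall>z. measure M {w \<in> space M. X w + Y w = z} > 0 \<longrightarrow>
        (let N = conditioned M (\<lambda>w. X w + Y w) z in
           distr N (count_space UNIV) (\<lambda>w. (X1 w, Y1 w)) =
             distr N (count_space UNIV) (\<lambda>w. (X w, Y w)) \<and>
           distr N (count_space UNIV) (\<lambda>w. (X2 w, Y2 w)) =
             distr N (count_space UNIV) (\<lambda>w. (X w, Y w))))"

text \<open>
  The entropic additive energy depends only on the joint law \<open>P\<close> of \<open>(X, Y)\<close>. It is defined from
  the canonical realisation of the trials: draw \<open>z\<close> from the law of the sum, then draw two
  independent pairs from \<open>P\<close> conditioned on having sum \<open>z\<close>.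
\<close>

definition law :: "'w measure \<Rightarrow> ('w \<Rightarrow> 'a) \<Rightarrow> 'a pmf" where
  "law M X = Abs_pmf (distr M (count_space UNIV) X)"

definition trials_pmf :: "('g::ab_group_add \<times> 'g) pmf \<Rightarrow> (('g \<times> 'g) \<times> ('g \<times> 'g)) pmf" where
  "trials_pmf P = bind_pmf (map_pmf (\<lambda>(x, y). x + y) P)
     (\<lambda>z. let Q = cond_pmf P {(x, y). x + y = z} in pair_pmf Q Q)"

definition additive_energy :: "'w measure \<Rightarrow> ('w \<Rightarrow> 'g::ab_group_add) \<Rightarrow> ('w \<Rightarrow> 'g) \<Rightarrow> ereal" where
  "additive_energy M X Y =
     shannon (measure_pmf (trials_pmf (law M (\<lambda>w. (X w, Y w)))))
       (\<lambda>((x1, y1), (x2, y2)). (x1, y1, x2, y2))"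

end

theory Submission
  imports Defs
begin

text \<open>
  All bounds come from submodularity of entropy (\<open>shannon_submodular\<close>), written
  \<open>H(U, V, S) + H(S) \<le> H(U, S) + H(V, S)\<close>, and its consequence
  \<open>H(X, Y) \<le> H(X) + H(Y)\<close>. Let \<open>S = X + Y\<close> and let \<open>A\<close> be the additive energy. The trials
  have the joint law from which \<open>A\<close> is defined (\<open>law_trials\<close>), so \<open>A\<close> is the entropy of
  \<open>(X1, Y1, X2, Y2)\<close>. Each trial has, jointly with \<open>S\<close>, the law of \<open>(X, Y)\<close>.

  Suppose \<open>H(X)\<close> and \<open>H(Y)\<close> are finite. Submodularity of the two trials over \<open>S\<close> gives
  \<open>A + H(S) \<le> 2 H(X, Y)\<close>. Any two of \<open>X1, Y1, S\<close> determine the third, so by the chain rule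
  (\<open>shannon_chain_rule\<close>) \<open>H(X1 | S) = H(X, Y) - H(S) = H(Y2 | S)\<close>. This common value is at least
  \<open>A - H(X, Y) \<ge> A - H(X) - H(Y)\<close>, hence, by the assumed lower bound on \<open>A\<close>, at least the
  mean of \<open>H(X)\<close> and \<open>H(Y)\<close> minus \<open>log C\<close>. It is also at most \<open>H(X)\<close> and at most \<open>H(Y)\<close>, so the two entropies differ by at
  most \<open>2 log C\<close>, and the mean can be replaced by either of them at the cost of another
  \<open>log C\<close>.

  For the upper bound, let \<open>D = X1 - X2 = Y2 - Y1\<close>. It is a function of \<open>(X1, X2)\<close> and of
  \<open>(Y1, Y2)\<close>, so submodularity over \<open>D\<close> gives
  \<open>A + H(D) \<le> H(X1, X2) + H(Y1, Y2) \<le> 2 H(X) + 2 H(Y)\<close>, which with the lower bound on \<open>A\<close> gives the required bound for \<open>H(D)\<close>. Since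
  \<open>X1 + Y2 = S + D\<close>, the conditional entropy of \<open>X1 + Y2\<close> given \<open>S\<close> equals that of \<open>D\<close>,
  which is at most \<open>H(D)\<close>. If \<open>H(X)\<close> or \<open>H(Y)\<close> is infinite, the upper bound is trivial.

  Submodularity is Gibbs' inequality. It is proved for mass functions
  (\<open>pmf_entropy_submodular\<close>), with values in \<open>[0, \<infinity>]\<close>, and transferred to random variables
  through their laws.
\<close>

section \<open>Unordered sums as integrals over the counting measure\<close>

text \<open>
  Shannon entropies are unordered sums, but Fubini, monotonicity and marginalisation are most
  convenient for the nonnegative integral. A countable support, which every mass function
  has, allows both sides to be reduced to a series over the naturals.
\<close>

lemma infsum_ennreal_eq_nn_integral:
  fixes f :: "'a \<Rightarrow> ennreal"
  assumes "countable {x. f x \<noteq> 0}"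
  shows "infsum f UNIV = (\<integral>\<^sup>+x. f x \<partial>count_space UNIV)"
proof -
  define B where "B = {x. f x \<noteq> 0}"
  have "infsum f UNIV = infsum f B"
    by (rule infsum_cong_neutral) (auto simp: B_def)
  also have "\<dots> = (\<integral>\<^sup>+x. f x \<partial>count_space B)"
  proof (cases "finite B")
    case True
    then show ?thesis by (simp add: nn_integral_count_space_finite)
  next
    case False
    with assms have bij: "bij_betw (from_nat_into B) UNIV B"
      by (intro bij_betw_from_nat_into) (auto simp: B_def)
    have "infsum f B = infsum (\<lambda>n. f (from_nat_into B n)) UNIV"
      by (rule infsum_reindex_bij_betw[OF bij, symmetric])
    also have "\<dots> = (\<Sum>n. f (from_nat_into B n))"
      by (intro sums_unique has_sum_imp_sums has_sum_infsum nonneg_summable_on_complete) simp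
    also have "\<dots> = (\<integral>\<^sup>+n. f (from_nat_into B n) \<partial>count_space UNIV)"
      by (rule nn_integral_count_space_nat[symmetric])
    also have "\<dots> = (\<integral>\<^sup>+x. f x \<partial>count_space B)"
      by (rule nn_integral_bij_count_space[OF bij])
    finally show ?thesis .
  qed
  also have "\<dots> = (\<integral>\<^sup>+x. f x \<partial>count_space UNIV)"
    by (rule nn_integral_count_space_eq) (auto simp: B_def)
  finally show ?thesis .
qed

lemma infsum_enn2ereal_eq_nn_integral:
  fixes f :: "'a \<Rightarrow> ennreal"
  assumes "countable {x. f x \<noteq> 0}"
  shows "(\<Sum>\<^sub>\<infinity>x. enn2ereal (f x)) = enn2ereal (\<integral>\<^sup>+x. f x \<partial>count_space UNIV)"
proof -
  have "infsum (enn2ereal \<circ> f) UNIV = enn2ereal (infsum f UNIV)"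
    by (rule infsum_comm_additive_general)
       (auto simp: continuous_at_enn2ereal plus_ennreal.rep_eq sum_enn2ereal intro: nonneg_summable_on_complete)
  then show ?thesis
    by (simp add: infsum_ennreal_eq_nn_integral[OF assms] o_def)
qed

section \<open>Entropy of a mass function and its submodularity\<close>

text \<open>
  Entropy is the expected surprisal. In this form the entropy of an image of \<open>p\<close> is again an
  expectation under \<open>p\<close>, so entropies of several functions of the same variable can be
  compared pointwise. The value is in \<open>[0, \<infinity>]\<close>, so no summability has to be discussed.
\<close>

definition pmf_entropy :: "'a pmf \<Rightarrow> ennreal" where
  "pmf_entropy p = (\<integral>\<^sup>+x. ennreal (log 2 (1 / pmf p x)) \<partial>measure_pmf p)"

lemma log_inverse_pmf_nonneg: "0 \<le> log 2 (1 / pmf p x)"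
proof (cases "pmf p x = 0")
  case False
  then have "0 < pmf p x" using pmf_nonneg[of p x] by linarith
  then show ?thesis using pmf_le_1[of p x] by simp
qed (simp add: log_def)

text \<open>
  The hypothesis is on point probabilities instead of on a law, because the variable need not
  have countable range: the canonical realisation of the trials lives on a possibly
  uncountable type of outcomes, only countably many of which carry mass.
\<close>

lemma shannon_eq_pmf_entropy:
  assumes "\<And>x. measure M {w \<in> space M. X w = x} = pmf q x"
  shows "shannon M X = enn2ereal (pmf_entropy q)"
proof -
  have "shannon M X = (\<Sum>\<^sub>\<infinity>x. enn2ereal (ennreal (pmf q x) * ennreal (log 2 (1 / pmf q x))))"
    unfolding shannon_def assms Let_def
    by (intro infsum_cong)
       (simp add: log_inverse_pmf_nonneg enn2ereal_ennreal flip: ennreal_mult)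
  also have "\<dots> = enn2ereal (\<integral>\<^sup>+x. ennreal (pmf q x) * ennreal (log 2 (1 / pmf q x)) \<partial>count_space UNIV)"
    by (intro infsum_enn2ereal_eq_nn_integral countable_subset[OF _ countable_set_pmf[of q]])
       (auto simp: set_pmf_iff)
  finally show ?thesis
    by (simp add: pmf_entropy_def nn_integral_measure_pmf)
qed

lemma pmf_entropy_map:
  "pmf_entropy (map_pmf f p) = (\<integral>\<^sup>+x. ennreal (log 2 (1 / pmf (map_pmf f p) (f x))) \<partial>measure_pmf p)"
  by (simp add: pmf_entropy_def)

lemma pmf_entropy_map_inj_on:
  assumes "inj_on f (set_pmf p)"
  shows "pmf_entropy (map_pmf f p) = pmf_entropy p"
  unfolding pmf_entropy_map unfolding pmf_entropy_def
  by (intro nn_integral_cong_AE) (simp add: AE_measure_pmf_iff pmf_map_inj[OF assms])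

lemma pmf_map_pos: "x \<in> set_pmf p \<Longrightarrow> 0 < pmf (map_pmf f p) (f x)"
  by (simp add: pmf_positive)

lemma nn_integral_pmf_marginal:
  "(\<integral>\<^sup>+x. ennreal (pmf p (x, z)) \<partial>count_space UNIV) = ennreal (pmf (map_pmf snd p) z)"
proof -
  have "(\<integral>\<^sup>+x. ennreal (pmf p (x, z)) \<partial>count_space UNIV)
      = (\<integral>\<^sup>+a. ennreal (pmf p a) \<partial>count_space (range (\<lambda>x. (x, z))))"
    by (rule nn_integral_bij_count_space) (auto simp: bij_betw_def inj_on_def)
  also have "range (\<lambda>x. (x, z)) = snd -` {z}" by force
  finally show ?thesis
    by (simp add: nn_integral_pmf pmf_map measure_pmf.emeasure_eq_measure)
qed

text \<open>
  This is \<open>ln t \<le> t - 1\<close> at \<open>t = a * b / (z * p)\<close>, multiplied by \<open>p\<close>. The two error terms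
  stay on opposite sides so that every summand is nonnegative and the inequality can be summed
  in \<open>[0, \<infinity>]\<close>.
\<close>

lemma gibbs_pointwise:
  fixes p z a b :: real
  assumes "0 < p" "0 < z" "0 < a" "0 < b"
  shows "p * log 2 (1 / p) + p * log 2 (1 / z) + p / ln 2
       \<le> p * log 2 (1 / a) + p * log 2 (1 / b) + (a * b / z) / ln 2"
proof -
  define t where "t = a * b / (z * p)"
  have t: "0 < t" using assms by (simp add: t_def)
  have "ln t = ln a + ln b - ln z - ln p"
    using assms by (simp add: t_def ln_div ln_mult)
  moreover have "p * ln t \<le> p * (t - 1)"
    using assms ln_le_minus_one[OF t] by simp
  moreover have "p * t = a * b / z" using assms by (simp add: t_def)
  ultimately have "p * (ln a + ln b - ln z - ln p) + p \<le> a * b / z"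
    by (simp only: right_diff_distrib)
  then have "(p * (ln a + ln b - ln z - ln p) + p) / ln 2 \<le> (a * b / z) / ln 2"
    by (intro divide_right_mono) auto
  then show ?thesis
    using assms by (simp add: log_def ln_div algebra_simps add_divide_distrib diff_divide_distrib)
qed

text \<open>
  Gibbs' inequality compares the joint mass function \<open>p\<close> with the mass function \<open>q\<close> that
  makes the first two coordinates conditionally independent given the third and keeps the
  two marginals that involve the third. Summed over all points, the error terms of the pointwise
  inequality are \<open>1 / ln 2\<close> for \<open>p\<close> and at most that for \<open>q\<close>. As this constant
  is finite it cancels, even where the entropies are infinite.
\<close>

lemma pmf_entropy_submodular:
  fixes p :: "('a \<times> 'b \<times> 'c) pmf"
  shows "pmf_entropy p + pmf_entropy (map_pmf (\<lambda>(x, y, z). z) p)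
       \<le> pmf_entropy (map_pmf (\<lambda>(x, y, z). (x, z)) p) + pmf_entropy (map_pmf (\<lambda>(x, y, z). (y, z)) p)"
proof -
  define pz where "pz = map_pmf (\<lambda>(x, y, z). z) p"
  define px where "px = map_pmf (\<lambda>(x, y, z). (x, z)) p"
  define py where "py = map_pmf (\<lambda>(x, y, z). (y, z)) p"
  define q where "q = (\<lambda>(x, y, z). pmf px (x, z) * pmf py (y, z) / pmf pz z)"
  have q0: "0 \<le> q v" for v by (auto simp: q_def split: prod.split)
  have mz: "map_pmf snd px = pz"
    by (simp add: px_def pz_def map_pmf_comp case_prod_unfold)
  \<comment> \<open>Summing out the first coordinate replaces its marginal by that of the third coordinate,
    which cancels the denominator wherever that is nonzero.\<close>
  have q1: "(\<integral>\<^sup>+v. ennreal (q v) \<partial>count_space UNIV) \<le> 1"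
  proof -
    have "(\<integral>\<^sup>+v. ennreal (q v) \<partial>count_space UNIV)
        = (\<integral>\<^sup>+x. \<integral>\<^sup>+yz. ennreal (q (x, yz)) \<partial>count_space UNIV \<partial>count_space UNIV)"
      by (rule nn_integral_fst_count_space[symmetric])
    also have "\<dots> = (\<integral>\<^sup>+yz. \<integral>\<^sup>+x. ennreal (q (x, yz)) \<partial>count_space UNIV \<partial>count_space UNIV)"
      by (simp only: nn_integral_fst_count_space[of "\<lambda>v. ennreal (q v)"]
          nn_integral_snd_count_space[of "\<lambda>v. ennreal (q v)"])
    also have "\<dots> = (\<integral>\<^sup>+yz. ennreal (pmf py yz / pmf pz (snd yz)) * ennreal (pmf pz (snd yz)) \<partial>count_space UNIV)"
    proof (intro nn_integral_cong)
      fix yz :: "'b \<times> 'c"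
      have "(\<integral>\<^sup>+x. ennreal (q (x, yz)) \<partial>count_space UNIV)
          = (\<integral>\<^sup>+x. ennreal (pmf py yz / pmf pz (snd yz)) * ennreal (pmf px (x, snd yz)) \<partial>count_space UNIV)"
        by (intro nn_integral_cong) (auto simp: q_def mult_ac simp flip: ennreal_mult split: prod.split)
      also have "\<dots> = ennreal (pmf py yz / pmf pz (snd yz)) * ennreal (pmf pz (snd yz))"
        by (simp add: nn_integral_cmult nn_integral_pmf_marginal mz)
      finally show "(\<integral>\<^sup>+x. ennreal (q (x, yz)) \<partial>count_space UNIV)
          = ennreal (pmf py yz / pmf pz (snd yz)) * ennreal (pmf pz (snd yz))" .
    qed
    also have "\<dots> \<le> (\<integral>\<^sup>+yz. ennreal (pmf py yz) \<partial>count_space UNIV)"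
      by (intro nn_integral_mono) (auto simp flip: ennreal_mult)
    also have "\<dots> = 1"
      by (simp add: nn_integral_pmf)
    finally show ?thesis .
  qed
  have H: "pmf_entropy (map_pmf f p)
      = (\<integral>\<^sup>+v. ennreal (pmf p v * log 2 (1 / pmf (map_pmf f p) (f v))) \<partial>count_space UNIV)" for f :: "('a \<times> 'b \<times> 'c) \<Rightarrow> 'd"
    by (simp add: pmf_entropy_map nn_integral_measure_pmf ennreal_mult log_inverse_pmf_nonneg)
  have Hid: "pmf_entropy p = (\<integral>\<^sup>+v. ennreal (pmf p v * log 2 (1 / pmf p v)) \<partial>count_space UNIV)"
    using H[of id] by (simp add: map_pmf_id)
  have one: "ennreal (1 / ln 2) = (\<integral>\<^sup>+v. ennreal (pmf p v / ln 2) \<partial>count_space UNIV)"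
    using nn_integral_cmult[of "\<lambda>v. ennreal (pmf p v)" "count_space UNIV" "ennreal (1 / ln 2)"]
    by (simp add: nn_integral_pmf flip: ennreal_mult)
  have qq: "(\<integral>\<^sup>+v. ennreal (q v / ln 2) \<partial>count_space UNIV) \<le> ennreal (1 / ln 2)"
  proof -
    have "(\<integral>\<^sup>+v. ennreal (q v / ln 2) \<partial>count_space UNIV)
        = ennreal (1 / ln 2) * (\<integral>\<^sup>+v. ennreal (q v) \<partial>count_space UNIV)"
      by (simp add: q0 flip: nn_integral_cmult ennreal_mult)
    also have "\<dots> \<le> ennreal (1 / ln 2) * 1" by (intro mult_left_mono q1) auto
    finally show ?thesis by simp
  qed
  have "pmf_entropy p + pmf_entropy pz + ennreal (1 / ln 2)
      = (\<integral>\<^sup>+v. ennreal (pmf p v * log 2 (1 / pmf p v) + pmf p v * log 2 (1 / pmf pz ((\<lambda>(x, y, z). z) v))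
            + pmf p v / ln 2) \<partial>count_space UNIV)"
    unfolding one Hid unfolding pz_def H
    by (simp add: nn_integral_add log_inverse_pmf_nonneg)
  also have "\<dots> \<le> (\<integral>\<^sup>+v. ennreal (pmf p v * log 2 (1 / pmf px ((\<lambda>(x, y, z). (x, z)) v))
            + pmf p v * log 2 (1 / pmf py ((\<lambda>(x, y, z). (y, z)) v)) + q v / ln 2) \<partial>count_space UNIV)"
  proof (intro nn_integral_mono ennreal_leI)
    fix v :: "'a \<times> 'b \<times> 'c"
    obtain x y z where v: "v = (x, y, z)" by (cases v)
    show "pmf p v * log 2 (1 / pmf p v) + pmf p v * log 2 (1 / pmf pz ((\<lambda>(x, y, z). z) v)) + pmf p v / ln 2
      \<le> pmf p v * log 2 (1 / pmf px ((\<lambda>(x, y, z). (x, z)) v))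
            + pmf p v * log 2 (1 / pmf py ((\<lambda>(x, y, z). (y, z)) v)) + q v / ln 2"
    proof (cases "v \<in> set_pmf p")
      case True
      have "0 < pmf p v" "0 < pmf pz z" "0 < pmf px (x, z)" "0 < pmf py (y, z)"
        using True pmf_map_pos[OF True, of "\<lambda>(x, y, z). z"] pmf_map_pos[OF True, of "\<lambda>(x, y, z). (x, z)"]
          pmf_map_pos[OF True, of "\<lambda>(x, y, z). (y, z)"]
        by (simp_all add: pmf_positive pz_def px_def py_def v)
      from gibbs_pointwise[OF this] show ?thesis by (simp add: v q_def)
    next
      case False
      then show ?thesis using q0[of v] by (simp add: set_pmf_iff)
    qed
  qed
  also have "\<dots> = pmf_entropy px + pmf_entropy py + (\<integral>\<^sup>+v. ennreal (q v / ln 2) \<partial>count_space UNIV)"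
    unfolding px_def py_def H by (simp add: nn_integral_add log_inverse_pmf_nonneg q0)
  also have "\<dots> \<le> pmf_entropy px + pmf_entropy py + ennreal (1 / ln 2)"
    by (intro add_left_mono qq)
  finally show ?thesis
    by (simp add: px_def py_def pz_def)
qed

section \<open>Discrete random variables and their laws\<close>

lemma discrete_rv_comp: "discrete_rv M X \<Longrightarrow> discrete_rv M (\<lambda>w. f (X w))"
  unfolding discrete_rv_def
  by (auto intro: measurable_compose simp flip: image_image)

lemma discrete_rv_sets: "discrete_rv M X \<Longrightarrow> {w \<in> space M. P (X w)} \<in> sets M"
  using measurable_sets[of X M "count_space UNIV" "{x. P x}"]
  by (simp add: discrete_rv_def vimage_def Int_def conj_commute)

text \<open>
  The discrete \<open>\<sigma>\<close>-algebra on a product of uncountable types can be larger than the product of the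
  discrete \<open>\<sigma>\<close>-algebras, so measurability of a pair relies on the countable ranges: a preimage is
  a countable union of fibres.
\<close>

lemma discrete_rv_Pair:
  assumes "discrete_rv M X" "discrete_rv M Y"
  shows "discrete_rv M (\<lambda>w. (X w, Y w))"
proof -
  let ?R = "X ` space M \<times> Y ` space M"
  have c: "countable ?R"
    using assms by (auto simp: discrete_rv_def)
  have "{w \<in> space M. X w = x \<and> Y w = y} \<in> sets M" for x y
    using sets.Int[OF discrete_rv_sets[OF assms(1), of "\<lambda>a. a = x"] discrete_rv_sets[OF assms(2), of "\<lambda>a. a = y"]]
    by (rule back_subst[of "\<lambda>A. A \<in> sets M"]) auto
  note fibre = this
  have "(\<lambda>w. (X w, Y w)) \<in> measurable M (count_space UNIV)"
  proof (rule measurableI)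
    fix A :: "('b \<times> 'c) set"
    have "(\<Union>(x, y)\<in>A \<inter> ?R. {w \<in> space M. X w = x \<and> Y w = y}) \<in> sets M"
      using c fibre by (intro sets.countable_UN') auto
    also have "(\<Union>(x, y)\<in>A \<inter> ?R. {w \<in> space M. X w = x \<and> Y w = y}) = (\<lambda>w. (X w, Y w)) -` A \<inter> space M"
      by auto
    finally show "(\<lambda>w. (X w, Y w)) -` A \<inter> space M \<in> sets M" .
  qed simp
  moreover have "(\<lambda>w. (X w, Y w)) ` space M \<subseteq> ?R" by auto
  ultimately show ?thesis
    using c countable_subset unfolding discrete_rv_def by blast
qed

lemma discrete_rv_comp2:
  "discrete_rv M X \<Longrightarrow> discrete_rv M Y \<Longrightarrow> discrete_rv M (\<lambda>w. f (X w) (Y w))"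
  using discrete_rv_comp[OF discrete_rv_Pair, of M X Y "\<lambda>(x, y). f x y"] by simp

lemma discrete_rv_conditioned: "discrete_rv M X \<Longrightarrow> discrete_rv (conditioned M Z z) X"
  unfolding discrete_rv_def conditioned_def
  by (simp add: measurable_cong_sets[OF sets_uniform_measure refl])

context prob_space
begin

text \<open>
  A mass function must give almost all of its mass to atoms. The points of probability
  zero in the range form a null set because the range is countable.
\<close>

lemma measure_pmf_law:
  assumes "discrete_rv M X"
  shows "measure_pmf (law M X) = distr M (count_space UNIV) X"
proof -
  let ?D = "distr M (count_space UNIV) X"
  have X: "X \<in> measurable M (count_space UNIV)" and c: "countable (X ` space M)"
    using assms by (auto simp: discrete_rv_def)
  have m: "measure ?D {x} = prob {w \<in> space M. X w = x}" for x
    by (simp add: measure_distr[OF X] vimage_def Int_def conj_commute)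
  have "AE w in M. \<forall>x\<in>X ` space M. measure ?D {x} = 0 \<longrightarrow> X w \<noteq> x"
    unfolding AE_ball_countable[OF c]
  proof (intro ballI)
    fix x
    show "AE w in M. measure ?D {x} = 0 \<longrightarrow> X w \<noteq> x"
      using prob_eq_0[OF discrete_rv_sets[OF assms, of "\<lambda>a. a = x"]] unfolding m by auto
  qed
  then have "AE w in M. measure ?D {X w} \<noteq> 0"
    using AE_space by eventually_elim auto
  then have "AE x in ?D. measure ?D {x} \<noteq> 0"
    by (subst AE_distr_iff[OF X]) auto
  moreover have "prob_space ?D"
    by (rule prob_space_distr[OF X])
  ultimately show ?thesis
    unfolding law_def by (intro Abs_pmf_inverse) simp
qed

lemma pmf_law:
  assumes "discrete_rv M X"
  shows "pmf (law M X) x = prob {w \<in> space M. X w = x}"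
proof -
  have "X \<in> measurable M (count_space UNIV)" using assms by (simp add: discrete_rv_def)
  then show ?thesis
    by (simp add: pmf.rep_eq measure_pmf_law[OF assms] measure_distr vimage_def Int_def conj_commute)
qed

lemma law_comp:
  assumes "discrete_rv M X"
  shows "law M (\<lambda>w. f (X w)) = map_pmf f (law M X)"
proof (rule pmf_eqI)
  fix y
  have "X \<in> measurable M (count_space UNIV)" using assms by (simp add: discrete_rv_def)
  then show "pmf (law M (\<lambda>w. f (X w))) y = pmf (map_pmf f (law M X)) y"
    by (simp add: pmf_law[OF discrete_rv_comp[OF assms]] pmf_map measure_pmf_law[OF assms]
        measure_distr vimage_def Int_def conj_commute)
qed

lemma AE_law:
  assumes "discrete_rv M X"
  shows "(AE w in M. P (X w)) \<longleftrightarrow> (\<forall>x\<in>set_pmf (law M X). P x)"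
proof -
  have "X \<in> measurable M (count_space UNIV)" using assms by (simp add: discrete_rv_def)
  then have "(AE w in M. P (X w)) \<longleftrightarrow> (AE x in measure_pmf (law M X). P x)"
    unfolding measure_pmf_law[OF assms] by (subst AE_distr_iff) auto
  then show ?thesis by (simp add: AE_measure_pmf_iff)
qed

section \<open>Shannon entropy inequalities\<close>

lemma shannon_eq: "discrete_rv M X \<Longrightarrow> shannon M X = enn2ereal (pmf_entropy (law M X))"
  by (intro shannon_eq_pmf_entropy) (simp add: pmf_law)

text \<open>
  Entropy does not change when each variable almost surely determines the other. The relations
  between sums and differences of the trials hold only almost surely, so pointwise
  injectivity would not suffice.
\<close>

lemma shannon_relabel:
  assumes X: "discrete_rv M X" and Y: "discrete_rv M Y"
    and f: "AE w in M. Y w = f (X w)" and g: "AE w in M. X w = g (Y w)"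
  shows "shannon M Y = shannon M X"
proof -
  have law: "law M Y = map_pmf f (law M X)"
  proof (rule pmf_eqI)
    fix y
    show "pmf (law M Y) y = pmf (map_pmf f (law M X)) y"
      unfolding law_comp[OF X, symmetric] pmf_law[OF Y] pmf_law[OF discrete_rv_comp[OF X]]
    proof (rule finite_measure_eq_AE)
      show "AE w in M. w \<in> {w \<in> space M. Y w = y} \<longleftrightarrow> w \<in> {w \<in> space M. f (X w) = y}"
        using f by eventually_elim auto
    qed (intro discrete_rv_sets[OF Y] discrete_rv_sets[OF discrete_rv_comp[OF X]])+
  qed
  have "AE w in M. X w = g (f (X w))"
    using f g by eventually_elim simp
  then have "\<forall>x\<in>set_pmf (law M X). x = g (f x)"
    using AE_law[OF X, of "\<lambda>x. x = g (f x)"] by blast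
  then have "inj_on f (set_pmf (law M X))"
    by (intro inj_on_inverseI[of _ g]) auto
  then show ?thesis
    by (simp add: shannon_eq X Y law pmf_entropy_map_inj_on)
qed

lemma shannon_submodular:
  assumes X: "discrete_rv M X" and Y: "discrete_rv M Y" and Z: "discrete_rv M Z"
  shows "shannon M (\<lambda>w. (X w, Y w, Z w)) + shannon M Z
       \<le> shannon M (\<lambda>w. (X w, Z w)) + shannon M (\<lambda>w. (Y w, Z w))"
proof -
  have XYZ: "discrete_rv M (\<lambda>w. (X w, Y w, Z w))"
    by (intro discrete_rv_Pair X Y Z)
  have "law M Z = map_pmf (\<lambda>(x, y, z). z) (law M (\<lambda>w. (X w, Y w, Z w)))"
    "law M (\<lambda>w. (X w, Z w)) = map_pmf (\<lambda>(x, y, z). (x, z)) (law M (\<lambda>w. (X w, Y w, Z w)))"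
    "law M (\<lambda>w. (Y w, Z w)) = map_pmf (\<lambda>(x, y, z). (y, z)) (law M (\<lambda>w. (X w, Y w, Z w)))"
    by (simp_all flip: law_comp[OF XYZ])
  then show ?thesis
    using pmf_entropy_submodular[of "law M (\<lambda>w. (X w, Y w, Z w))"]
    by (simp add: shannon_eq X Y Z discrete_rv_Pair less_eq_ennreal.rep_eq plus_ennreal.rep_eq)
qed

lemma discrete_rv_const: "discrete_rv M (\<lambda>_. c)"
  by (auto simp: discrete_rv_def intro: countable_subset[of _ "{c}"])

lemma shannon_const: "shannon M (\<lambda>_. c) = 0"
proof -
  have "law M (\<lambda>_. c) = return_pmf c"
    by (intro pmf_eqI) (auto simp: pmf_law discrete_rv_const prob_space indicator_def)
  then show ?thesis
    by (simp add: shannon_eq discrete_rv_const pmf_entropy_def zero_ennreal.rep_eq)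
qed

text \<open>
  Submodularity over a constant third variable.
\<close>

lemma shannon_subadditive:
  assumes X: "discrete_rv M X" and Y: "discrete_rv M Y"
  shows "shannon M (\<lambda>w. (X w, Y w)) \<le> shannon M X + shannon M Y"
proof -
  have "shannon M (\<lambda>w. (X w, Y w, ())) = shannon M (\<lambda>w. (X w, Y w))"
    by (rule shannon_relabel[where f = "\<lambda>(x, y). (x, y, ())" and g = "\<lambda>(x, y, z). (x, y)"])
       (auto intro!: discrete_rv_Pair X Y discrete_rv_const)
  moreover have "shannon M (\<lambda>w. (X w, ())) = shannon M X"
    by (rule shannon_relabel[where f = "\<lambda>x. (x, ())" and g = fst])
       (auto intro!: discrete_rv_Pair X Y discrete_rv_const)
  moreover have "shannon M (\<lambda>w. (Y w, ())) = shannon M Y"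
    by (rule shannon_relabel[where f = "\<lambda>x. (x, ())" and g = fst])
       (auto intro!: discrete_rv_Pair X Y discrete_rv_const)
  ultimately show ?thesis
    using shannon_submodular[OF X Y discrete_rv_const[of "()"]] by (simp add: shannon_const)
qed

lemma prob_space_conditioned:
  "0 < prob {w \<in> space M. Z w = z} \<Longrightarrow> prob_space (conditioned M Z z)"
  unfolding conditioned_def
  by (intro prob_space_uniform_measure) (auto simp: emeasure_eq_measure)

lemma measure_conditioned:
  assumes X: "discrete_rv M X" and Z: "discrete_rv M Z" and "0 < prob {w \<in> space M. Z w = z}"
  shows "measure (conditioned M Z z) {w \<in> space M. X w = x}
       = pmf (law M (\<lambda>w. (X w, Z w))) (x, z) / pmf (law M Z) z"
proof -
  have "measure (conditioned M Z z) {w \<in> space M. X w = x}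
      = prob ({w \<in> space M. Z w = z} \<inter> {w \<in> space M. X w = x}) / prob {w \<in> space M. Z w = z}"
    unfolding conditioned_def
    using assms by (intro measure_uniform_measure discrete_rv_sets[OF X]) (auto simp: emeasure_eq_measure)
  also have "{w \<in> space M. Z w = z} \<inter> {w \<in> space M. X w = x} = {w \<in> space M. (X w, Z w) = (x, z)}"
    by auto
  finally show ?thesis
    by (simp add: pmf_law Z discrete_rv_Pair[OF X Z])
qed

text \<open>
  With \<open>p\<close> the joint law and \<open>r\<close> the law of \<open>Z\<close>, the surprisal of a pair \<open>(x, z)\<close> splits as
  \<open>log (1 / p (x, z)) = log (r z / p (x, z)) + log (1 / r z)\<close>. The expectation of the first part,
  summed along the fibres of \<open>Z\<close>, is the conditional entropy. Both parts are nonnegative, so the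
  identity holds in \<open>[0, \<infinity>]\<close>.
\<close>

lemma shannon_chain_rule:
  assumes X: "discrete_rv M X" and Z: "discrete_rv M Z"
  shows "shannon M (\<lambda>w. (X w, Z w)) = cond_shannon M X Z + shannon M Z"
proof -
  define p where "p = law M (\<lambda>w. (X w, Z w))"
  define r where "r = map_pmf snd p"
  have XZ: "discrete_rv M (\<lambda>w. (X w, Z w))" by (intro discrete_rv_Pair X Z)
  have r: "r = law M Z" unfolding r_def p_def by (simp flip: law_comp[OF XZ])
  have p_r: "0 < pmf r z" if "0 < pmf p (x, z)" for x z
    using that pmf_map_pos[of "(x, z)" p snd] by (simp add: r_def set_pmf_iff)
  have p_le: "pmf p (x, z) \<le> pmf r z" for x z
    unfolding r_def pmf_map by (simp add: pmf.rep_eq measure_pmf.finite_measure_mono)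
  define t where "t = (\<lambda>(x, z). log 2 (pmf r z / pmf p (x, z)))"
  have t0: "0 \<le> t v" for v
  proof (cases v)
    case (Pair x z)
    show ?thesis
    proof (cases "pmf p (x, z) = 0")
      case False
      then have "0 < pmf p (x, z)" using pmf_nonneg[of p "(x, z)"] by linarith
      then show ?thesis
        using p_le[of x z] by (simp add: t_def Pair)
    qed (simp add: t_def Pair log_def)
  qed
  \<comment> \<open>The conditional mass function is \<open>p (x, z) / r z\<close>, and the weight \<open>r z\<close> clears the denominator.\<close>
  have fib: "ereal (prob {w \<in> space M. Z w = z}) * shannon (conditioned M Z z) X
      = enn2ereal (\<integral>\<^sup>+x. ennreal (pmf p (x, z) * t (x, z)) \<partial>count_space UNIV)" for z
  proof (cases "pmf r z = 0")
    case True
    then have "pmf p (x, z) = 0" for x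
      using p_le[of x z] pmf_nonneg[of p "(x, z)"] by simp
    moreover have "prob {w \<in> space M. Z w = z} = 0" using True by (simp add: r pmf_law Z)
    ultimately show ?thesis by (simp add: zero_ennreal.rep_eq flip: zero_ereal_def)
  next
    case False
    then have rz: "0 < pmf r z" using pmf_nonneg[of r z] by linarith
    then have Zz: "0 < prob {w \<in> space M. Z w = z}" by (simp add: r pmf_law Z)
    interpret N: prob_space "conditioned M Z z" by (rule prob_space_conditioned[OF Zz])
    have spN: "space (conditioned M Z z) = space M" "sets (conditioned M Z z) = sets M"
      by (simp_all add: conditioned_def)
    have XN: "discrete_rv (conditioned M Z z) X"
      by (rule discrete_rv_conditioned[OF X])
    define q where "q = law (conditioned M Z z) X"
    have q: "pmf q x = pmf p (x, z) / pmf r z" for x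
      using measure_conditioned[OF X Z Zz, of x]
      by (simp add: q_def N.pmf_law[OF XN] spN p_def r)
    have "ereal (prob {w \<in> space M. Z w = z}) * shannon (conditioned M Z z) X
        = enn2ereal (ennreal (pmf r z) * pmf_entropy q)"
      by (simp add: N.shannon_eq[OF XN] q_def r pmf_law Z times_ennreal.rep_eq)
    also have "ennreal (pmf r z) * pmf_entropy q
        = (\<integral>\<^sup>+x. ennreal (pmf r z) * (ennreal (pmf q x) * ennreal (log 2 (1 / pmf q x))) \<partial>count_space UNIV)"
      by (simp add: pmf_entropy_def nn_integral_measure_pmf nn_integral_cmult)
    also have "\<dots> = (\<integral>\<^sup>+x. ennreal (pmf p (x, z) * t (x, z)) \<partial>count_space UNIV)"
    proof (intro nn_integral_cong)
      fix x
      show "ennreal (pmf r z) * (ennreal (pmf q x) * ennreal (log 2 (1 / pmf q x)))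
          = ennreal (pmf p (x, z) * t (x, z))"
        using rz log_inverse_pmf_nonneg[of q x]
        by (simp add: q t_def flip: ennreal_mult mult.assoc)
    qed
    finally show ?thesis .
  qed
  have "cond_shannon M X Z
      = enn2ereal (\<integral>\<^sup>+z. \<integral>\<^sup>+x. ennreal (pmf p (x, z) * t (x, z)) \<partial>count_space UNIV \<partial>count_space UNIV)"
    unfolding cond_shannon_def fib
  proof (rule infsum_enn2ereal_eq_nn_integral)
    have "(\<integral>\<^sup>+x. ennreal (pmf p (x, z) * t (x, z)) \<partial>count_space UNIV) = 0" if "z \<notin> set_pmf r" for z
    proof -
      have "pmf p (x, z) = 0" for x
        using that p_r[of x z] pmf_nonneg[of p "(x, z)"] by (auto simp: set_pmf_iff less_le)
      then show ?thesis by simp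
    qed
    then show "countable {z. (\<integral>\<^sup>+x. ennreal (pmf p (x, z) * t (x, z)) \<partial>count_space UNIV) \<noteq> 0}"
      by (intro countable_subset[OF _ countable_set_pmf[of r]]) blast
  qed
  also have "(\<integral>\<^sup>+z. \<integral>\<^sup>+x. ennreal (pmf p (x, z) * t (x, z)) \<partial>count_space UNIV \<partial>count_space UNIV)
      = (\<integral>\<^sup>+v. ennreal (t v) \<partial>measure_pmf p)"
    unfolding nn_integral_snd_count_space[of "\<lambda>v. ennreal (pmf p v * t v)"]
    by (simp add: nn_integral_measure_pmf ennreal_mult t0)
  finally have c: "cond_shannon M X Z = enn2ereal (\<integral>\<^sup>+v. ennreal (t v) \<partial>measure_pmf p)" .
  have "(\<integral>\<^sup>+v. ennreal (t v) \<partial>measure_pmf p) + pmf_entropy r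
      = (\<integral>\<^sup>+v. ennreal (t v + log 2 (1 / pmf r (snd v))) \<partial>measure_pmf p)"
    by (simp add: r_def pmf_entropy_map nn_integral_add t0 log_inverse_pmf_nonneg)
  also have "\<dots> = pmf_entropy p"
    unfolding pmf_entropy_def
  proof (intro nn_integral_cong_AE, unfold AE_measure_pmf_iff, intro ballI)
    fix v assume v: "v \<in> set_pmf p"
    have "0 < pmf p v" "0 < pmf r (snd v)"
      using v pmf_map_pos[OF v, of snd] by (simp_all add: pmf_positive r_def)
    then show "ennreal (t v + log 2 (1 / pmf r (snd v))) = ennreal (log 2 (1 / pmf p v))"
      by (simp add: t_def log_divide split_beta)
  qed
  finally show ?thesis
    by (simp add: shannon_eq XZ Z c flip: p_def r plus_ennreal.rep_eq)
qed

section \<open>Conditionally independent trials\<close>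

lemma law_pair_eq_conditioned:
  assumes X: "discrete_rv M X" and Z: "discrete_rv M Z"
  shows "pmf (law M (\<lambda>w. (X w, Z w))) (x, z)
    = pmf (law M Z) z * measure (conditioned M Z z) {w \<in> space M. X w = x}"
proof (cases "pmf (law M Z) z = 0")
  case True
  have "prob {w \<in> space M. (X w, Z w) = (x, z)} \<le> prob {w \<in> space M. Z w = z}"
    by (intro finite_measure_mono discrete_rv_sets[OF Z]) auto
  with True show ?thesis
    by (simp add: pmf_law Z discrete_rv_Pair[OF X Z] measure_le_0_iff)
next
  case False
  then have "0 < prob {w \<in> space M. Z w = z}"
    using pmf_nonneg[of "law M Z" z] by (simp add: pmf_law Z less_le)
  then show ?thesis
    using False by (simp add: measure_conditioned[OF X Z])
qed

text \<open>
  Agreement of the conditional laws given \<open>Z\<close> passes to the joint laws with \<open>Z\<close>. It is in this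
  form that the trials inherit every marginal of the original pair together with the sum.
\<close>

lemma law_pair_eqI_conditioned:
  assumes U: "discrete_rv M U" and W: "discrete_rv M W" and Z: "discrete_rv M Z"
    and eq: "\<And>z. 0 < prob {w \<in> space M. Z w = z} \<Longrightarrow>
      distr (conditioned M Z z) (count_space UNIV) U = distr (conditioned M Z z) (count_space UNIV) W"
  shows "law M (\<lambda>w. (U w, Z w)) = law M (\<lambda>w. (W w, Z w))"
proof (rule pmf_eqI, clarify)
  fix a z
  show "pmf (law M (\<lambda>w. (U w, Z w))) (a, z) = pmf (law M (\<lambda>w. (W w, Z w))) (a, z)"
  proof (cases "0 < prob {w \<in> space M. Z w = z}")
    case True
    have m: "V \<in> measurable (conditioned M Z z) (count_space UNIV)" if "discrete_rv M V" for V :: "'a \<Rightarrow> 'b"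
      using discrete_rv_conditioned[OF that, of Z z] by (simp add: discrete_rv_def)
    have d: "measure (distr (conditioned M Z z) (count_space UNIV) V) {a}
        = measure (conditioned M Z z) {w \<in> space M. V w = a}" if "discrete_rv M V" for V :: "'a \<Rightarrow> 'b"
      using m[OF that]
      by (simp add: measure_distr vimage_def Int_def conj_commute conditioned_def)
    show ?thesis
      using d[OF U] d[OF W] eq[OF True] by (simp add: law_pair_eq_conditioned U W Z)
  next
    case False
    then have "pmf (law M Z) z = 0" by (simp add: pmf_law Z zero_less_measure_iff)
    then show ?thesis by (simp add: law_pair_eq_conditioned U W Z)
  qed
qed

text \<open>
  The trials on the given space have the law of the canonical realisation, for an arbitrary
  function \<open>s\<close> in the role of the sum. This holds because both draw the value \<open>z\<close> of \<open>s\<close> first and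
  then two independent samples from \<open>Q z\<close>. It is easiest to compare the laws of the samples
  together with \<open>z\<close>, where every point mass is a product of three factors, and then to
  forget \<open>z\<close>.
\<close>

lemma law_trials:
  fixes U V W :: "'a \<Rightarrow> 'b" and s :: "'b \<Rightarrow> 'c"
  assumes U: "discrete_rv M U" and V: "discrete_rv M V" and W: "discrete_rv M W"
    and ind: "cond_indep M U V (\<lambda>w. s (W w))"
    and eqU: "law M (\<lambda>w. (U w, s (W w))) = law M (\<lambda>w. (W w, s (W w)))"
    and eqV: "law M (\<lambda>w. (V w, s (W w))) = law M (\<lambda>w. (W w, s (W w)))"
  shows "law M (\<lambda>w. (U w, V w)) = bind_pmf (map_pmf s (law M W))
     (\<lambda>z. let Q = cond_pmf (law M W) {x. s x = z} in pair_pmf Q Q)"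
proof -
  define P where "P = law M W"
  define Q where "Q z = cond_pmf P {x. s x = z}" for z
  define Z where "Z = (\<lambda>w. s (W w))"
  have Z: "discrete_rv M Z" unfolding Z_def by (rule discrete_rv_comp[OF W])
  have eqU: "law M (\<lambda>w. (U w, Z w)) = law M (\<lambda>w. (W w, Z w))"
    and eqV: "law M (\<lambda>w. (V w, Z w)) = law M (\<lambda>w. (W w, Z w))"
    using eqU eqV by (simp_all add: Z_def)
  have lawZ: "law M Z = map_pmf s P" unfolding Z_def P_def by (rule law_comp[OF W])
  have cond: "measure (conditioned M Z z) {w \<in> space M. T w = a} = pmf (Q z) a"
    if z: "0 < prob {w \<in> space M. Z w = z}" and T: "discrete_rv M T"
      and eq: "law M (\<lambda>w. (T w, Z w)) = law M (\<lambda>w. (W w, Z w))" for T z a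
  proof -
    have "0 < pmf (map_pmf s P) z" using z by (simp add: pmf_law Z flip: lawZ)
    then have ne: "set_pmf P \<inter> {x. s x = z} \<noteq> {}"
      by (auto simp flip: set_pmf_iff simp: pmf_positive_iff)
    have "pmf (law M (\<lambda>w. (W w, Z w))) (a, z) = (if s a = z then pmf P a else 0)"
    proof -
      have "{w \<in> space M. W w = a \<and> s (W w) = z} = (if s a = z then {w \<in> space M. W w = a} else {})"
        by auto
      then show ?thesis
        by (simp add: pmf_law discrete_rv_Pair W Z P_def) (simp add: Z_def)
    qed
    then show ?thesis
      by (simp add: measure_conditioned[OF T Z z] eq lawZ Q_def pmf_cond[OF ne] pmf_map vimage_def)
  qed
  have "law M (\<lambda>w. ((U w, V w), Z w))
      = bind_pmf (law M Z) (\<lambda>z. map_pmf (\<lambda>v. (v, z)) (pair_pmf (Q z) (Q z)))" (is "?L = ?R")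
  proof (rule pmf_eqI, clarify)
    fix a b z
    have "pmf ?R ((a, b), z) = (\<integral>z'. indicator {z} z' * (pmf (Q z) a * pmf (Q z) b) \<partial>measure_pmf (law M Z))"
      unfolding pmf_bind
    proof (intro Bochner_Integration.integral_cong refl)
      fix z'
      show "pmf (map_pmf (\<lambda>v. (v, z')) (pair_pmf (Q z') (Q z'))) ((a, b), z)
          = indicator {z} z' * (pmf (Q z) a * pmf (Q z) b)"
      proof (cases "z' = z")
        case True
        have "pmf (map_pmf (\<lambda>v. (v, z)) (pair_pmf (Q z) (Q z))) ((a, b), z) = pmf (pair_pmf (Q z) (Q z)) (a, b)"
          by (rule pmf_map_inj') (simp add: inj_def)
        then show ?thesis by (simp add: True pmf_pair)
      qed (auto intro!: pmf_map_outside)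
    qed
    also have "\<dots> = pmf (law M Z) z * (pmf (Q z) a * pmf (Q z) b)"
      by (simp add: pmf.rep_eq)
    also have "\<dots> = pmf ?L ((a, b), z)"
    proof (cases "0 < prob {w \<in> space M. Z w = z}")
      case True
      interpret N: prob_space "conditioned M Z z" by (rule prob_space_conditioned[OF True])
      have "N.indep_var (count_space UNIV) U (count_space UNIV) V"
        using ind True unfolding cond_indep_def Z_def by blast
      from N.indep_varD[OF this, of "{a}" "{b}"]
      have "measure (conditioned M Z z) {w \<in> space M. (U w, V w) = (a, b)}
          = measure (conditioned M Z z) {w \<in> space M. U w = a} * measure (conditioned M Z z) {w \<in> space M. V w = b}"
        by (simp add: vimage_def Int_def conj_commute conditioned_def)
      then show ?thesis
        using cond[OF True U eqU] cond[OF True V eqV]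
        by (simp add: law_pair_eq_conditioned[OF discrete_rv_Pair[OF U V] Z])
    next
      case False
      then have "pmf (law M Z) z = 0" by (simp add: pmf_law Z zero_less_measure_iff)
      then show ?thesis by (simp add: law_pair_eq_conditioned[OF discrete_rv_Pair[OF U V] Z])
    qed
    finally show "pmf ?L ((a, b), z) = pmf ?R ((a, b), z)" ..
  qed
  then have "map_pmf fst ?L = map_pmf fst ?R" by simp
  then show ?thesis
    by (simp add: discrete_rv_Pair U V Z lawZ map_bind_pmf map_pmf_comp Q_def P_def Let_def
        flip: law_comp)
qed

lemma shannon_cong_law:
  assumes "discrete_rv M U" "discrete_rv M V" "law M U = law M V"
  shows "shannon M (\<lambda>w. f (U w)) = shannon M (\<lambda>w. f (V w))"
  using assms by (simp add: shannon_eq discrete_rv_comp law_comp)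

end

section \<open>Entropies relative to the sum\<close>

theorem theorem6:
  fixes M :: "'w measure"
    and X Y X1 Y1 X2 Y2 :: "'w \<Rightarrow> 'g::ab_group_add"
    and C :: real
  assumes "prob_space M"
    and "discrete_rv M X" and "discrete_rv M Y"
    and "C > 0"
    and "additive_energy M X Y
           \<ge> ereal (3 / 2) * shannon M X + ereal (3 / 2) * shannon M Y - ereal (log 2 C)"
    and "cond_indep_trials M X Y X1 Y1 X2 Y2"
  shows "(shannon M X < \<infinity> \<and> shannon M Y < \<infinity> \<longrightarrow>
            cond_shannon M X1 (\<lambda>w. X w + Y w) \<ge> shannon M X - ereal (2 * log 2 C) \<and>
            cond_shannon M Y2 (\<lambda>w. X w + Y w) \<ge> shannon M Y - ereal (2 * log 2 C)) \<and>
         cond_indep M X1 Y2 (\<lambda>w. X w + Y w) \<and>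
         cond_shannon M (\<lambda>w. X1 w + Y2 w) (\<lambda>w. X w + Y w)
           \<le> ereal (1 / 2) * shannon M X + ereal (1 / 2) * shannon M Y + ereal (log 2 C)"
proof -
  interpret prob_space M by fact
  note X = assms(2) and Y = assms(3)
  have D: "discrete_rv M X1" "discrete_rv M Y1" "discrete_rv M X2" "discrete_rv M Y2"
    and ind: "cond_indep M (\<lambda>w. (X1 w, Y1 w)) (\<lambda>w. (X2 w, Y2 w)) (\<lambda>w. X w + Y w)"
    using assms(6) by (auto simp: cond_indep_trials_def)
  define S where "S = (\<lambda>w. X w + Y w)"
  define U where "U = (\<lambda>w. (X1 w, Y1 w))"
  define V where "V = (\<lambda>w. (X2 w, Y2 w))"
  define W where "W = (\<lambda>w. (X w, Y w))"
  define D12 where "D12 = (\<lambda>w. X1 w - X2 w)"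
  have S: "discrete_rv M S" and U: "discrete_rv M U" and V: "discrete_rv M V" and W: "discrete_rv M W"
    and D12: "discrete_rv M D12"
    unfolding S_def U_def V_def W_def D12_def
    by (rule discrete_rv_comp2[OF X Y] discrete_rv_Pair[OF D(1,2)] discrete_rv_Pair[OF D(3,4)]
        discrete_rv_Pair[OF X Y] discrete_rv_comp2[OF D(1,3)])+
  note [simp] = discrete_rv_Pair X Y D S U V W D12 discrete_rv_comp2[OF X Y]
    discrete_rv_comp2[of M X1 X2 "(-)"]
  have UW: "law M (\<lambda>w. (U w, S w)) = law M (\<lambda>w. (W w, S w))"
    and VW: "law M (\<lambda>w. (V w, S w)) = law M (\<lambda>w. (W w, S w))"
    using assms(6)
    by (intro law_pair_eqI_conditioned U V W S; simp add: cond_indep_trials_def Let_def S_def U_def V_def W_def)+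
  have SW: "S = (\<lambda>w. fst (W w) + snd (W w))" by (simp add: S_def W_def)
  have "law M (\<lambda>w. (U w, V w)) = trials_pmf (law M W)"
    unfolding trials_pmf_def case_prod_unfold
    using law_trials[OF U V W _ UW[unfolded SW] VW[unfolded SW]] ind[folded U_def V_def S_def, unfolded SW]
    by blast
  then have energy: "additive_energy M X Y = shannon M (\<lambda>w. (U w, V w))"
  proof -
    let ?g = "\<lambda>((x1, y1), (x2, y2)). (x1 :: 'g, y1 :: 'g, x2 :: 'g, y2 :: 'g)"
    let ?T = "trials_pmf (law M (\<lambda>w. (X w, Y w)))"
    have "additive_energy M X Y = enn2ereal (pmf_entropy (map_pmf ?g ?T))"
      unfolding additive_energy_def by (intro shannon_eq_pmf_entropy) (simp add: pmf_map vimage_def)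
    also have "pmf_entropy (map_pmf ?g ?T) = pmf_entropy ?T"
      by (intro pmf_entropy_map_inj_on) (auto simp: inj_on_def)
    finally show ?thesis
      using \<open>law M (\<lambda>w. (U w, V w)) = trials_pmf (law M W)\<close>
      by (simp add: shannon_eq W_def)
  qed
  have supp: "\<forall>v\<in>set_pmf (law M (\<lambda>w. (W w, S w))). fst (fst v) + snd (fst v) = snd v"
    using AE_law[OF discrete_rv_Pair[OF W S], of "\<lambda>v. fst (fst v) + snd (fst v) = snd v"]
    by (simp add: S_def W_def)
  have sumU: "AE w in M. X1 w + Y1 w = S w"
    using supp AE_law[OF discrete_rv_Pair[OF U S], of "\<lambda>v. fst (fst v) + snd (fst v) = snd v"]
    unfolding UW by (simp add: U_def)
  have sumV: "AE w in M. X2 w + Y2 w = S w"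
    using supp AE_law[OF discrete_rv_Pair[OF V S], of "\<lambda>v. fst (fst v) + snd (fst v) = snd v"]
    unfolding VW by (simp add: V_def)
  note trU = shannon_cong_law[OF _ _ UW, simplified]
  note trV = shannon_cong_law[OF _ _ VW, simplified]
  \<comment> \<open>Any two of \<open>X\<close>, \<open>Y\<close>, \<open>S\<close> determine the third, so each such pair has the entropy of \<open>W\<close>.\<close>
  have WS: "shannon M (\<lambda>w. (W w, S w)) = shannon M W"
    by (rule shannon_relabel[where f = "\<lambda>p. (p, fst p + snd p)" and g = fst]) (auto simp: W_def S_def)
  have XS: "shannon M (\<lambda>w. (X w, S w)) = shannon M W"
    by (rule shannon_relabel[where f = "\<lambda>(x, y). (x, x + y)" and g = "\<lambda>(x, s). (x, s - x)"]) (auto simp: W_def S_def)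
  have YS: "shannon M (\<lambda>w. (Y w, S w)) = shannon M W"
    by (rule shannon_relabel[where f = "\<lambda>(x, y). (y, x + y)" and g = "\<lambda>(y, s). (s - y, y)"]) (auto simp: W_def S_def)
  have mX: "shannon M X1 = shannon M X" "shannon M X2 = shannon M X"
    and mY: "shannon M Y1 = shannon M Y" "shannon M Y2 = shannon M Y"
    using trU[of "\<lambda>v. fst (fst v)"] trV[of "\<lambda>v. fst (fst v)"] trU[of "\<lambda>v. snd (fst v)"] trV[of "\<lambda>v. snd (fst v)"]
    by (simp_all add: U_def V_def W_def)
  have mXS: "shannon M (\<lambda>w. (X1 w, S w)) = shannon M W"
    using trU[of "\<lambda>v. (fst (fst v), snd v)"] XS by (simp add: U_def W_def)
  have mYS: "shannon M (\<lambda>w. (Y2 w, S w)) = shannon M W"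
    using trV[of "\<lambda>v. (snd (fst v), snd v)"] YS by (simp add: V_def W_def)
  have mUS: "shannon M (\<lambda>w. (U w, S w)) = shannon M W" "shannon M (\<lambda>w. (V w, S w)) = shannon M W"
    using trU[of "\<lambda>v. v"] trV[of "\<lambda>v. v"] WS by simp_all
  \<comment> \<open>Both trials determine \<open>S\<close>, so submodularity over \<open>S\<close> bounds the additive energy.\<close>
  have "shannon M (\<lambda>w. (U w, V w, S w)) = shannon M (\<lambda>w. (U w, V w))"
    by (rule shannon_relabel[where f = "\<lambda>(u, v). (u, v, fst u + snd u)" and g = "\<lambda>(u, v, s). (u, v)"])
       (use sumU in \<open>auto simp: U_def\<close>)
  with shannon_submodular[OF U V S]
  have E: "additive_energy M X Y + shannon M S \<le> shannon M W + shannon M W"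
    by (simp add: energy mUS)
  have cX: "shannon M W = cond_shannon M X1 S + shannon M S"
    using shannon_chain_rule[OF D(1) S] mXS by simp
  have cY: "shannon M W = cond_shannon M Y2 S + shannon M S"
    using shannon_chain_rule[OF D(4) S] mYS by simp
  have jX: "shannon M W \<le> shannon M X + shannon M S"
    using shannon_subadditive[OF X S] XS by simp
  have jY: "shannon M W \<le> shannon M Y + shannon M S"
    using shannon_subadditive[OF Y S] YS by simp
  have j: "shannon M W \<le> shannon M X + shannon M Y"
    using shannon_subadditive[OF X Y] by (simp add: W_def)
  \<comment> \<open>The difference of the trials is a function of \<open>(X1, X2)\<close>, and also of \<open>(Y1, Y2)\<close> because the
    sums agree. Together these two pairs carry the whole additive energy.\<close>
  have fibre: "additive_energy M X Y + shannon M D12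
      \<le> (shannon M X + shannon M X) + (shannon M Y + shannon M Y)"
  proof -
    have all: "shannon M (\<lambda>w. ((X1 w, X2 w), (Y1 w, Y2 w), D12 w)) = shannon M (\<lambda>w. (U w, V w))"
      by (rule shannon_relabel[where f = "\<lambda>((x1, y1), (x2, y2)). ((x1, x2), (y1, y2), x1 - x2)"
            and g = "\<lambda>((x1, x2), (y1, y2), d). ((x1, y1), (x2, y2))"])
         (auto simp: U_def V_def D12_def)
    have x: "shannon M (\<lambda>w. ((X1 w, X2 w), D12 w)) = shannon M (\<lambda>w. (X1 w, X2 w))"
      by (rule shannon_relabel[where f = "\<lambda>(x1, x2). ((x1, x2), x1 - x2)" and g = fst])
         (auto simp: D12_def)
    have "AE w in M. D12 w = Y2 w - Y1 w"
      using sumU sumV by eventually_elim (simp add: D12_def algebra_simps)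
    then have y: "shannon M (\<lambda>w. ((Y1 w, Y2 w), D12 w)) = shannon M (\<lambda>w. (Y1 w, Y2 w))"
      by (intro shannon_relabel[where f = "\<lambda>(y1, y2). ((y1, y2), y2 - y1)" and g = fst]) auto
    have "additive_energy M X Y + shannon M D12 \<le> shannon M (\<lambda>w. (X1 w, X2 w)) + shannon M (\<lambda>w. (Y1 w, Y2 w))"
      using shannon_submodular[of "\<lambda>w. (X1 w, X2 w)" "\<lambda>w. (Y1 w, Y2 w)" D12] by (simp add: all x y energy)
    also have "\<dots> \<le> (shannon M X + shannon M X) + (shannon M Y + shannon M Y)"
      using shannon_subadditive[OF D(1) D(3)] shannon_subadditive[OF D(2) D(4)]
      by (intro add_mono) (simp_all add: mX mY)
    finally show ?thesis .
  qed
  have T: "discrete_rv M (\<lambda>w. X1 w + Y2 w)" by (rule discrete_rv_comp2[OF D(1,4)])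
  \<comment> \<open>Given \<open>S\<close>, the variable \<open>X1 + Y2\<close> is the translate of the difference by \<open>S\<close>.\<close>
  have cT: "cond_shannon M (\<lambda>w. X1 w + Y2 w) S + shannon M S \<le> shannon M D12 + shannon M S"
  proof -
    have "AE w in M. X1 w + Y2 w = S w + D12 w" "AE w in M. D12 w = X1 w + Y2 w - S w"
      using sumV by (eventually_elim, simp add: D12_def algebra_simps)+
    then have "shannon M (\<lambda>w. (X1 w + Y2 w, S w)) = shannon M (\<lambda>w. (D12 w, S w))"
      by (intro shannon_relabel[where f = "\<lambda>(d, s). (s + d, s)" and g = "\<lambda>(t, s). (t - s, s)"])
         (simp_all add: T)
    then show ?thesis
      using shannon_subadditive[OF D12 S] shannon_chain_rule[OF T S] by simp
  qed
  have ind': "cond_indep M X1 Y2 S"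
    unfolding cond_indep_def
  proof (intro allI impI)
    fix z assume z: "0 < prob {w \<in> space M. S w = z}"
    interpret N: prob_space "conditioned M S z" by (rule prob_space_conditioned[OF z])
    have "N.indep_var (count_space UNIV) U (count_space UNIV) V"
      using ind z unfolding cond_indep_def S_def U_def V_def by blast
    from N.indep_var_compose[OF this, of fst "count_space UNIV" snd "count_space UNIV"]
    show "N.indep_var (count_space UNIV) X1 (count_space UNIV) Y2"
      by (simp add: U_def V_def o_def)
  qed
  have nn: "0 \<le> shannon M X" "0 \<le> shannon M Y" "0 \<le> shannon M W" "0 \<le> shannon M S"
    "0 \<le> shannon M D12" "0 \<le> additive_energy M X Y"
    by (auto simp: shannon_eq energy)
  show ?thesis
  proof (cases "shannon M X < \<infinity> \<and> shannon M Y < \<infinity>")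
    case True
    obtain x where x: "shannon M X = ereal x" using True nn(1) by (cases "shannon M X") auto
    obtain y where y: "shannon M Y = ereal y" using True nn(2) by (cases "shannon M Y") auto
    obtain j' where j': "shannon M W = ereal j'" using j nn(3) x y by (cases "shannon M W") auto
    obtain s where s: "shannon M S = ereal s" using E nn j' by (cases "shannon M S") auto
    obtain d where d: "shannon M D12 = ereal d" using fibre nn x y by (cases "shannon M D12") auto
    obtain a where a: "additive_energy M X Y = ereal a"
      using E nn j' by (cases "additive_energy M X Y") auto
    obtain c1 where c1: "cond_shannon M X1 S = ereal c1"
      using cX j' s by (cases "cond_shannon M X1 S") auto
    obtain c2 where c2: "cond_shannon M Y2 S = ereal c2"
      using cY j' s by (cases "cond_shannon M Y2 S") auto
    have ct: "cond_shannon M (\<lambda>w. X1 w + Y2 w) S \<le> ereal d"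
      using cT d s by (cases "cond_shannon M (\<lambda>w. X1 w + Y2 w) S") auto
    have h: "3 / 2 * x + 3 / 2 * y - log 2 C \<le> a"
      using assms(5) by (simp add: x y a)
    have rs: "a + s \<le> 2 * j'" "j' = c1 + s" "j' = c2 + s" "j' \<le> x + s" "j' \<le> y + s" "j' \<le> x + y"
      "a + d \<le> 2 * x + 2 * y"
      using E cX cY jX jY j fibre by (simp_all add: x y a j' s d c1 c2)
    \<comment> \<open>The hypothesis with \<open>a + s \<le> 2 * j'\<close> and \<open>j' \<le> x + y\<close> bounds \<open>c1 = c2 = j' - s\<close> below by
      \<open>x / 2 + y / 2 - log 2 C\<close>. As \<open>j' - s\<close> is at most \<open>x\<close> and at most \<open>y\<close>, this forces
      \<open>x\<close> and \<open>y\<close> to differ by at most \<open>2 * log 2 C\<close>.\<close>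
    have "x - 2 * log 2 C \<le> c1" "y - 2 * log 2 C \<le> c2" "d \<le> 1 / 2 * x + 1 / 2 * y + log 2 C"
      using h rs by linarith+
    then show ?thesis
      using ind' ct order.trans[OF ct, of "ereal (1 / 2 * x + 1 / 2 * y + log 2 C)"]
      by (simp add: x y c1 c2 flip: S_def)
  next
    case False
    then have "shannon M X = \<infinity> \<or> shannon M Y = \<infinity>" by auto
    then have "ereal (1 / 2) * shannon M X + ereal (1 / 2) * shannon M Y + ereal (log 2 C) = \<infinity>"
      using nn(1,2) by auto
    with False ind' show ?thesis by (auto simp flip: S_def)
  qed
qed

end
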